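(* Let $N_c\ge1$ be an integer, $N_f=N_c+3$, and let $0\le t,\tilde t<1$. Write $s=t\tilde t$. Then the unrefined Hilbert series of $U(N_c)=U(N_f-3)$ SQCD with $N_f$ flavours is $$g_{N_f,U(N_f-3)}(t,\tilde t)=\frac{\mathcal D}{(1-s)^{N_f^2}},$$ where $$\begin{aligned}\mathcal D=\ &1-s^{N_f-2}\left[(1-s)^2\left(\binom{N_f}{2}-\binom{N_f+1}{2}s\right)^2+s\left(2N_f^2(1-s)^2+3s\right)\right]\\&+s^{2N_f-2}\Bigg[(1-s)^2\left(\binom{N_f}{2}-s\binom{N_f+1}{2}\right)\left(\binom{N_f}{2}-s\binom{N_f+1}{2}-2(1-s)N_f^2\right)\\&\qquad\qquad+N_f^4(1-s)^4+2N_f^2(1-s)^2s+3s^2\Bigg]-s^{3N_f}.\end{aligned}$$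
   Context: The unrefined Hilbert series of $U(N_c)$ SQCD with $N_f$ flavours is $$g_{N_f,U(N_c)}(t,\tilde t)=\frac{1}{N_c!(2\pi i)^{N_c}}\oint_{|z_1|=1}\frac{dz_1}{z_1}\cdots\oint_{|z_{N_c}|=1}\frac{dz_{N_c}}{z_{N_c}}\prod_{1\le a<b\le N_c}|z_a-z_b|^2\prod_{a=1}^{N_c}\frac{1}{(1-t/z_a)^{N_f}(1-\tilde t z_a)^{N_f}}.$$ *)

theory Defs
  imports "HOL-Complex_Analysis.Complex_Analysis"
begin

(* \<oint> dz_1/z_1 ... \<oint> dz_n/z_n F(z) over the unit circles |z_a| = 1, with z_1 outermost.
   The variables are z 1, ..., z n; the base assignment 0 only fills the positions outside {1..n},
   on which the integrands considered below do not depend. *)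
primrec torus_contour_integral :: "nat \<Rightarrow> ((nat \<Rightarrow> complex) \<Rightarrow> complex) \<Rightarrow> complex" where
  "torus_contour_integral 0 F = F (\<lambda>_. 0)"
| "torus_contour_integral (Suc n) F =
     torus_contour_integral n
       (\<lambda>z. contour_integral (circlepath 0 1) (\<lambda>w. F (z(Suc n := w)) / w))"

definition sqcd_integrand :: "nat \<Rightarrow> nat \<Rightarrow> real \<Rightarrow> real \<Rightarrow> (nat \<Rightarrow> complex) \<Rightarrow> complex" where
  "sqcd_integrand Nf Nc t tt z =
     (\<Prod>a\<in>{1..Nc}. \<Prod>b\<in>{a<..Nc}. complex_of_real ((norm (z a - z b))\<^sup>2)) *
     (\<Prod>a\<in>{1..Nc}. 1 / ((1 - complex_of_real t / z a) ^ Nf * (1 - complex_of_real tt * z a) ^ Nf))"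

definition sqcd_hilbert_series :: "nat \<Rightarrow> nat \<Rightarrow> real \<Rightarrow> real \<Rightarrow> complex" where
  "sqcd_hilbert_series Nf Nc t tt =
     1 / (fact Nc * (2 * complex_of_real pi * \<i>) ^ Nc) *
     torus_contour_integral Nc (sqcd_integrand Nf Nc t tt)"

end

(* The integral is Heine's formula for the Nc x Nc Toeplitz determinant with entries
   L(z^(M-1-i+j)), where M = Nf and L(g) = 1/(2 pi i) times the integral of g / (P q) over the unit
   circle, P = (z-t)^M, q = (1-tt z)^M. The functional L kills the multiples of P (the zeros of q lie
   outside the circle), so it lives on the M-dimensional space of polynomials modulo P, and multiplying
   the full M x M Toeplitz matrix by the matrix Q of multiplication by q makes it unitriangular.
   As in Jacobi's complementary minor theorem, the Nc x Nc minor times det Q = (1-s)^(M^2) is the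
   complementary 3 x 3 minor of Q, which only involves q, z q and z^2 q modulo P. *)

theory Submission
  imports Defs "Jordan_Normal_Form.Determinant"
begin

hide_const (open) Module.smult

section \<open>Multiplication modulo a monic polynomial\<close>

lemma mod_monic_eq:
  fixes P :: "'a :: field poly"
  assumes "lead_coeff P = 1" and "degree P > 0" and "degree g \<le> degree P"
  shows "g mod P = g - smult (coeff g (degree P)) P"
proof -
  let ?R = "g - smult (coeff g (degree P)) P"
  have "degree ?R \<le> degree P"
    using assms(3) degree_smult_le by (rule degree_diff_le)
  moreover have "coeff ?R (degree P) = 0" using assms(1) by simp
  ultimately have "degree ?R < degree P"
    using assms(2) eq_zero_or_degree_less[of ?R "degree P"] by auto
  hence "?R mod P = ?R" by (rule mod_poly_less)
  moreover have "?R mod P = g mod P"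
    by (simp add: poly_mod_diff_left mod_smult_left)
  ultimately show ?thesis by simp
qed

lemma degree_mod_less_pos:
  fixes P :: "'a :: field poly"
  assumes "degree P > 0"
  shows "degree (f mod P) < degree P"
  using degree_mod_less[of P f] assms by fastforce

text \<open>Multiplying a remainder by the variable raises its degree by at most one, so a single
  step of long division restores it. This recursion later yields the remainders of z q and z^2 q
  from that of q.\<close>

lemma mod_shift_eq:
  fixes P :: "'a :: field poly"
  assumes "lead_coeff P = 1" and "degree P > 0"
  shows "(monom 1 (Suc l) * g) mod P =
         pCons 0 ((monom 1 l * g) mod P) - smult (coeff ((monom 1 l * g) mod P) (degree P - 1)) P"
proof -
  define G where "G = (monom 1 l * g) mod P"
  have dG: "degree G < degree P"
    unfolding G_def by (rule degree_mod_less_pos[OF assms(2)])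
  have "(monom 1 (Suc l) * g) mod P = pCons 0 G mod P"
    using mod_mult_right_eq[of "[:0, 1:]" "monom 1 l * g" P] by (simp add: G_def monom_Suc)
  also have "\<dots> = pCons 0 G - smult (coeff (pCons 0 G) (degree P)) P"
    using dG degree_pCons_le[of 0 G] by (intro mod_monic_eq assms) simp
  also have "coeff (pCons 0 G) (degree P) = coeff G (degree P - 1)"
    using assms(2) by (cases "degree P") auto
  finally show ?thesis by (simp add: G_def)
qed

text \<open>The matrix of multiplication by g on the polynomials modulo P. Rows and columns run through the
  powers of the variable in descending order, so that Toeplitz matrices appear with their usual
  orientation.\<close>

definition mulmat :: "'a :: field poly \<Rightarrow> 'a poly \<Rightarrow> 'a mat" where
  "mulmat P g = mat (degree P) (degree P)
     (\<lambda>(i, j). coeff ((monom 1 (degree P - Suc i) * g) mod P) (degree P - Suc j))"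

lemma mulmat_carrier [simp]: "mulmat P g \<in> carrier_mat (degree P) (degree P)"
  by (simp add: mulmat_def)

lemma dim_mulmat [simp]: "dim_row (mulmat P g) = degree P" "dim_col (mulmat P g) = degree P"
  by (simp_all add: mulmat_def)

lemma poly_as_sum_monom_mult:
  fixes G h :: "'a :: comm_semiring_1 poly"
  assumes "degree G < n"
  shows "G * h = (\<Sum>k<n. smult (coeff G k) (monom 1 k * h))"
proof -
  have "G = (\<Sum>k<n. monom (coeff G k) k)"
    by (rule poly_eqI) (use assms in \<open>auto simp: coeff_sum coeff_eq_0\<close>)
  hence "G * h = (\<Sum>k<n. monom (coeff G k) k) * h" by simp
  also have "\<dots> = (\<Sum>k<n. smult (coeff G k) (monom 1 k * h))"
    by (simp add: sum_distrib_right smult_monom flip: mult_smult_left)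
  finally show ?thesis .
qed

lemma poly_mod_sum:
  fixes f :: "'b \<Rightarrow> 'a :: field poly"
  shows "(\<Sum>k\<in>A. f k) mod P = (\<Sum>k\<in>A. f k mod P)"
  by (induction A rule: infinite_finite_induct) (simp_all add: poly_mod_add_left)

text \<open>Row i lists the coefficients of z^(n-1-i) g modulo P, where n is the degree of P.
  Replacing each power of z by its product with h modulo P is linear, and reduction modulo P
  respects products.\<close>

lemma mulmat_mult:
  fixes P g h :: "'a :: field poly"
  assumes "degree P > 0"
  shows "mulmat P g * mulmat P h = mulmat P (g * h)"
proof (rule eq_matI)
  let ?n = "degree P"
  fix i j assume "i < dim_row (mulmat P (g * h))" "j < dim_col (mulmat P (g * h))"
  hence ij: "i < ?n" "j < ?n" by simp_all
  define G where "G = (monom 1 (?n - Suc i) * g) mod P"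
  have dG: "degree G < ?n"
    unfolding G_def by (rule degree_mod_less_pos[OF assms])
  have "(mulmat P g * mulmat P h) $$ (i, j) =
      (\<Sum>k<?n. coeff G (?n - Suc k) * coeff ((monom 1 (?n - Suc k) * h) mod P) (?n - Suc j))"
    using ij by (auto simp: scalar_prod_def mulmat_def G_def lessThan_atLeast0 intro!: sum.cong)
  \<comment> \<open>Reversing the summation index undoes the descending order of the powers.\<close>
  also have "\<dots> = (\<Sum>k<?n. coeff G k * coeff ((monom 1 k * h) mod P) (?n - Suc j))"
    by (rule sum.nat_diff_reindex)
  also have "\<dots> = coeff ((\<Sum>k<?n. smult (coeff G k) (monom 1 k * h)) mod P) (?n - Suc j)"
    by (simp add: poly_mod_sum coeff_sum mod_smult_left)
  also have "\<dots> = coeff ((G * h) mod P) (?n - Suc j)"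
    using poly_as_sum_monom_mult[OF dG, of h] by simp
  also have "(G * h) mod P = (monom 1 (?n - Suc i) * (g * h)) mod P"
    by (simp add: G_def mod_mult_left_eq mult.assoc)
  finally show "(mulmat P g * mulmat P h) $$ (i, j) = mulmat P (g * h) $$ (i, j)"
    using ij by (simp add: mulmat_def)
qed simp_all

lemma mulmat_one: "mulmat P 1 = 1\<^sub>m (degree P)"
  by (rule eq_matI) (auto simp: mulmat_def mod_poly_less degree_monom_eq)

section \<open>Determinant of multiplication by powers of 1 - w z\<close>

lemma prod_list_diag_mat:
  "A \<in> carrier_mat n n \<Longrightarrow> prod_list (diag_mat A) = (\<Prod>i<n. A $$ (i, i))"
  by (simp add: prod_list_diag_prod atLeast0LessThan)

text \<open>Multiplication by z on the quotient by P has the roots of P as eigenvalues, so the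
  determinant is the product of 1 - w x over the roots x, which is the reversed polynomial at w. The
  elimination below never splits P and so works over any field.\<close>

lemma det_mulmat_linear:
  fixes P :: "'a :: field poly"
  assumes monic: "lead_coeff P = 1" and deg: "degree P > 0"
  shows "det (mulmat P [:1, -w:]) = poly (reflect_poly P) w"
proof -
  let ?n = "degree P"
  define A where "A = mulmat P [:1, -w:]"
  txt \<open>A is a companion-type matrix; the unitriangular V clears it below the diagonal.\<close>
  define V :: "'a mat" where "V = mat ?n ?n (\<lambda>(i, j). if j \<le> i then w ^ (i - j) else 0)"
  have A: "A \<in> carrier_mat ?n ?n" and V: "V \<in> carrier_mat ?n ?n"
    by (simp_all add: A_def V_def)
  have lin: "monom 1 k * [:1, -w:] = monom 1 k - monom w (Suc k)" for k
  proof -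
    have "[:1, -w:] = monom 1 0 - monom w 1"
      by (simp add: monom_0 monom_Suc)
    thus ?thesis by (simp only: right_diff_distrib mult_monom) simp
  qed
  \<comment> \<open>Only row 0, belonging to z^(n-1), reaches degree n and has to be reduced modulo
    P. The other rows are read off directly.\<close>
  have A_Suc: "A $$ (Suc i, k) = (if k = Suc i then 1 else 0) - (if k = i then w else 0)"
    if "Suc i < ?n" "k < ?n" for i k
  proof -
    have "degree (monom 1 (?n - Suc (Suc i)) - monom w (?n - Suc i)) < ?n"
      by (rule degree_diff_less) (use that in \<open>auto intro: le_less_trans[OF degree_monom_le]\<close>)
    thus ?thesis
      using that by (auto simp: A_def mulmat_def lin mod_poly_less Suc_diff_Suc simp del: mult_pCons_right)
  qed
  have A_0: "A $$ (0, k) = (if k = 0 then 1 else 0) + w * coeff P (?n - Suc k)"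
    if "k < ?n" for k
  proof -
    let ?g = "monom 1 (?n - 1) - monom w ?n"
    have "degree ?g \<le> ?n"
      by (intro degree_diff_le degree_monom_le[THEN order_trans]) auto
    moreover have "coeff ?g ?n = - w" using deg by auto
    ultimately have "?g mod P = ?g - smult (- w) P"
      using mod_monic_eq[OF monic deg] by metis
    hence R: "(monom 1 (?n - Suc 0) * [:1, -w:]) mod P = ?g - smult (- w) P"
      unfolding lin using deg by simp
    have "A $$ (0, k) = coeff (?g - smult (- w) P) (?n - Suc k)"
      unfolding A_def mulmat_def using deg that
      by (subst R[symmetric]) (simp del: mult_pCons_right mult_pCons_left)
    moreover have "?n - 1 = ?n - Suc k \<longleftrightarrow> k = 0" "?n \<noteq> ?n - Suc k"
      using that deg by arith+
    ultimately show ?thesis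
      by (simp only: coeff_add coeff_diff coeff_monom coeff_smult) simp
  qed
  have AV: "(A * V) $$ (i, j) = (\<Sum>k<?n. A $$ (i, k) * V $$ (k, j))" if "i < ?n" "j < ?n" for i j
    using that by (simp add: A_def V_def scalar_prod_def lessThan_atLeast0)
  have AV_Suc: "(A * V) $$ (Suc i, j) = (if j = Suc i then 1 else 0)" if "Suc i < ?n" "j < ?n" for i j
  proof -
    have "(A * V) $$ (Suc i, j) = (\<Sum>k<?n. (if k = Suc i then V $$ (k, j) else 0) - (if k = i then w * V $$ (k, j) else 0))"
      unfolding AV[OF that] using that by (intro sum.cong) (auto simp: A_Suc)
    also have "\<dots> = V $$ (Suc i, j) - w * V $$ (i, j)"
      using that by (simp add: sum_subtractf)
    also have "\<dots> = (if j = Suc i then 1 else 0)"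
      using that by (auto simp: V_def Suc_diff_le)
    finally show ?thesis .
  qed
  have "(A * V) $$ (0, 0) = (\<Sum>k<?n. (if k = 0 then 1 else 0) + w ^ Suc k * coeff P (?n - Suc k))"
    unfolding AV[OF deg deg] using deg by (intro sum.cong) (auto simp: A_0 V_def algebra_simps)
  also have "\<dots> = 1 + (\<Sum>k<?n. w ^ Suc k * coeff P (?n - Suc k))"
    using deg by (simp add: sum.distrib)
  \<comment> \<open>Since P is monic, the isolated 1 is the k = 0 term of the sum for the reversed
    polynomial.\<close>
  also have "\<dots> = (\<Sum>k\<le>?n. coeff P (?n - k) * w ^ k)"
    using monic by (simp add: sum.atMost_shift mult.commute)
  also have "\<dots> = (\<Sum>k\<le>?n. coeff (reflect_poly P) k * w ^ k)"
    by (intro sum.cong) (auto simp: coeff_reflect_poly)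
  also have "\<dots> = poly (reflect_poly P) w"
    unfolding poly_altdef
    by (rule sum.mono_neutral_right) (use degree_reflect_poly_le[of P] in \<open>auto simp: coeff_eq_0\<close>)
  finally have AV0: "(A * V) $$ (0, 0) = poly (reflect_poly P) w" .
  have "(A * V) $$ (i, j) = 0" if "i < ?n" "j < i" for i j
    using that AV_Suc by (cases i) (simp_all del: index_mult_mat(1))
  hence "upper_triangular (A * V)"
    using A V unfolding upper_triangular_def by (simp del: index_mult_mat(1))
  hence "det (A * V) = (\<Prod>i<?n. (A * V) $$ (i, i))"
    using A V by (simp add: det_upper_triangular[of _ ?n] prod_list_diag_mat[of _ ?n])
  also have "\<dots> = (\<Prod>i<?n. if i = 0 then poly (reflect_poly P) w else 1)"
    by (intro prod.cong) (auto simp: AV0 gr0_conv_Suc AV_Suc)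
  also have "\<dots> = poly (reflect_poly P) w"
    using deg by simp
  finally have "det A * det V = poly (reflect_poly P) w"
    using det_mult[OF A V] by simp
  moreover have "det V = 1"
    by (subst det_lower_triangular[of ?n]) (auto simp: V_def prod_list_diag_mat[of _ ?n])
  ultimately show ?thesis by (simp add: A_def)
qed

lemma det_mulmat_linear_power:
  fixes P :: "'a :: field poly"
  assumes "lead_coeff P = 1" and "degree P > 0"
  shows "det (mulmat P ([:1, -w:] ^ n)) = poly (reflect_poly P) w ^ n"
proof (induction n)
  case 0
  show ?case by (simp add: mulmat_one)
next
  case (Suc n)
  have "mulmat P ([:1, -w:] ^ Suc n) = mulmat P [:1, -w:] * mulmat P ([:1, -w:] ^ n)"
    using assms by (simp add: mulmat_mult)
  thus ?case
    using Suc assms by (simp add: det_mult[of _ "degree P"] det_mulmat_linear)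
qed

text \<open>With Q the matrix of multiplication by q and T the Toeplitz matrix of L, the product of Q
  with the block matrix (T11, 0; T21, 1) is (S, Q12; 0, Q22) for a unitriangular S.\<close>

lemma det_minor_linear_functional:
  fixes P q :: "'a :: field poly" and L :: "'a poly \<Rightarrow> 'a"
  assumes deg: "degree P = N + K"
    and add: "\<And>f g. L (f + g) = L f + L g" and smult: "\<And>c f. L (smult c f) = c * L f"
    and P: "\<And>f. L (P * f) = 0"
    and less: "\<And>n. Suc n < N + K \<Longrightarrow> L (monom 1 n * q) = 0"
    and eq: "\<And>n. Suc n = N + K \<Longrightarrow> L (monom 1 n * q) = 1"
  shows "det (mulmat P q) * det (mat N N (\<lambda>(i, j). L (monom 1 (N + K - Suc i + j)))) =
         det (mat K K (\<lambda>(i, j). mulmat P q $$ (N + i, N + j)))"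
proof -
  have L0: "L 0 = 0" using smult[of 0 0] by simp
  have Lsum: "L (sum f A) = (\<Sum>k\<in>A. L (f k))" for f :: "nat \<Rightarrow> 'a poly" and A
    by (induction A rule: infinite_finite_induct) (simp_all add: add L0)
  let ?n = "N + K"
  define Q where "Q = mulmat P q"
  define T1 where "T1 = mat N N (\<lambda>(i, j). L (monom 1 (?n - Suc i + j)))"
  define T2 where "T2 = mat K N (\<lambda>(i, j). L (monom 1 (?n - Suc (N + i) + j)))"
  define Q2 where "Q2 = mat N K (\<lambda>(i, j). Q $$ (i, N + j))"
  define Q4 where "Q4 = mat K K (\<lambda>(i, j). Q $$ (N + i, N + j))"
  define S where "S = mat N N (\<lambda>(i, j). L (monom 1 (?n - Suc i + j) * q))"
  define B where "B = four_block_mat T1 (0\<^sub>m N K) T2 (1\<^sub>m K)"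
  have dims: "T1 \<in> carrier_mat N N" "T2 \<in> carrier_mat K N" "Q2 \<in> carrier_mat N K"
    "Q4 \<in> carrier_mat K K" "S \<in> carrier_mat N N" "Q \<in> carrier_mat ?n ?n" "B \<in> carrier_mat ?n ?n"
    by (auto simp: T1_def T2_def Q2_def Q4_def S_def Q_def B_def deg carrier_matI)
  \<comment> \<open>Row i of Q holds the coefficients of z^(n-1-i) q modulo P. Remainder and
    dividend differ by a multiple of P, which L kills even after multiplication by z^j.\<close>
  have QL: "(\<Sum>k<?n. Q $$ (i, k) * L (monom 1 (?n - Suc k + j))) = L (monom 1 (?n - Suc i + j) * q)"
    if i: "i < ?n" for i j
  proof -
    define F where "F = monom 1 (?n - Suc i) * q"
    define G where "G = F mod P"
    define H where "H = F div P"
    have dG: "degree G < ?n"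
      using degree_mod_less_pos[of P F] deg i by (cases "?n = 0") (simp_all add: G_def)
    have "(\<Sum>k<?n. Q $$ (i, k) * L (monom 1 (?n - Suc k + j)))
        = (\<Sum>k<?n. coeff G (?n - Suc k) * L (monom 1 (?n - Suc k + j)))"
      using i by (intro sum.cong) (auto simp: Q_def mulmat_def deg G_def F_def)
    also have "\<dots> = (\<Sum>k<?n. coeff G k * L (monom 1 (k + j)))"
      by (rule sum.nat_diff_reindex)
    also have "\<dots> = L (G * monom 1 j)"
      unfolding poly_as_sum_monom_mult[OF dG] by (simp add: Lsum smult mult_monom)
    also have "\<dots> = L (G * monom 1 j) + L (P * (H * monom 1 j))"
      by (simp add: P)
    also have "\<dots> = L ((H * P + G) * monom 1 j)"
      unfolding add[symmetric] by (simp add: algebra_simps)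
    also have "H * P + G = F"
      by (simp add: G_def H_def)
    also have "F * monom 1 j = monom 1 (?n - Suc i + j) * q"
      by (simp add: F_def mult.assoc mult.commute[of q] mult_monom flip: mult.assoc[of "monom 1 _" "monom 1 _"])
    finally show ?thesis .
  qed
  have QB: "Q * B = four_block_mat S Q2 (0\<^sub>m K N) Q4"
  proof (rule eq_matI)
    fix i j assume "i < dim_row (four_block_mat S Q2 (0\<^sub>m K N) Q4)"
      "j < dim_col (four_block_mat S Q2 (0\<^sub>m K N) Q4)"
    hence ij: "i < ?n" "j < ?n" using dims by simp_all
    have *: "(Q * B) $$ (i, j) = (\<Sum>k<?n. Q $$ (i, k) * B $$ (k, j))"
      using ij dims by (auto simp: scalar_prod_def lessThan_atLeast0)
    show "(Q * B) $$ (i, j) = four_block_mat S Q2 (0\<^sub>m K N) Q4 $$ (i, j)"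
    proof (cases "j < N")
      case True
      have "(Q * B) $$ (i, j) = (\<Sum>k<?n. Q $$ (i, k) * L (monom 1 (?n - Suc k + j)))"
        unfolding * using True by (intro sum.cong) (auto simp: B_def T1_def T2_def add.commute[of K])
      also have "\<dots> = L (monom 1 (?n - Suc i + j) * q)"
        using QL ij by simp
      \<comment> \<open>For i >= N > j the exponent n - 1 - i + j is below n - 1, so
        \<open>less\<close> produces the zero block.\<close>
      finally show ?thesis
        using ij True dims by (auto simp: S_def less)
    next
      case False
      have "(Q * B) $$ (i, j) = (\<Sum>k<?n. if k = j then Q $$ (i, k) else 0)"
        unfolding * using False ij by (intro sum.cong) (auto simp: B_def T1_def T2_def)
      also have "\<dots> = Q $$ (i, j)" using ij by simp
      finally show ?thesis
        using ij False dims by (auto simp: Q2_def Q4_def S_def)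
    qed
  qed (use dims in auto)
  \<comment> \<open>The exponent in S is n - 1 on the diagonal and smaller below it, so
    \<open>eq\<close> and \<open>less\<close> make S upper unitriangular.\<close>
  have "det S = 1"
    by (subst det_upper_triangular[of _ N])
      (auto simp: S_def prod_list_diag_mat[of _ N] less eq intro!: prod.neutral)
  moreover have "det (Q * B) = det S * det Q4"
    unfolding QB by (rule det_four_block_mat_lower_left_zero) (use dims in auto)
  moreover have "det B = det T1"
    unfolding B_def by (subst det_four_block_mat_upper_right_zero[of _ N _ K]) (use dims in auto)
  ultimately have "det Q * det T1 = det Q4"
    using det_mult[of Q ?n B] dims by simp
  thus ?thesis by (simp add: Q_def T1_def Q4_def)
qed

section \<open>Heine's formula\<close>

text \<open>Only values on the torus enter, so the factors |z_a - z_b|^2 may later be replaced by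
  rational functions that agree with them only there.\<close>

lemma torus_contour_integral_cong:
  assumes "\<And>z. (\<And>a. a \<in> {1..n} \<Longrightarrow> norm (z a) = 1) \<Longrightarrow> F z = G z"
  shows "torus_contour_integral n F = torus_contour_integral n G"
  using assms
proof (induction n arbitrary: F G)
  case 0
  thus ?case by simp
next
  case (Suc n)
  show ?case
    unfolding torus_contour_integral.simps
  proof (rule Suc.IH, rule contour_integral_eq)
    fix z :: "nat \<Rightarrow> complex" and w
    assume "\<And>a. a \<in> {1..n} \<Longrightarrow> norm (z a) = 1" "w \<in> path_image (circlepath 0 1)"
    thus "F (z(Suc n := w)) / w = G (z(Suc n := w)) / w"
      by (subst Suc.prems) auto
  qed
qed

text \<open>Every term is a product of one-variable functions, so linearity suffices and no exchange
  of integrals is needed. The innermost integral, over the last variable, is absorbed into the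
  coefficient; hence the induction runs over arbitrary c.\<close>

lemma torus_contour_integral_sum_prod:
  assumes "finite K"
    and "\<And>k a. k \<in> K \<Longrightarrow> a \<in> {1..n} \<Longrightarrow> (\<lambda>w. f k a w / w) contour_integrable_on circlepath 0 1"
  shows "torus_contour_integral n (\<lambda>z. \<Sum>k\<in>K. c k * (\<Prod>a\<in>{1..n}. f k a (z a))) =
         (\<Sum>k\<in>K. c k * (\<Prod>a\<in>{1..n}. contour_integral (circlepath 0 1) (\<lambda>w. f k a w / w)))"
  using assms(2)
proof (induction n arbitrary: c)
  case 0
  thus ?case by simp
next
  case (Suc n)
  let ?I = "\<lambda>k a. contour_integral (circlepath 0 1) (\<lambda>w. f k a w / w)"
  have "contour_integral (circlepath 0 1)
      (\<lambda>w. (\<Sum>k\<in>K. c k * (\<Prod>a\<in>{1..Suc n}. f k a ((z(Suc n := w)) a))) / w) =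
      (\<Sum>k\<in>K. (c k * ?I k (Suc n)) * (\<Prod>a\<in>{1..n}. f k a (z a)))" for z
  proof -
    have upd: "(\<Prod>a = Suc 0..n. f k a (if a = Suc n then w else z a)) = (\<Prod>a = Suc 0..n. f k a (z a))" for k w
      by (rule prod.cong) auto
    have "contour_integral (circlepath 0 1)
          (\<lambda>w. (\<Sum>k\<in>K. c k * (\<Prod>a\<in>{1..Suc n}. f k a ((z(Suc n := w)) a))) / w) =
        contour_integral (circlepath 0 1) (\<lambda>w. \<Sum>k\<in>K. (c k * (\<Prod>a\<in>{1..n}. f k a (z a))) * (f k (Suc n) w / w))"
      by (simp add: sum_divide_distrib prod.nat_ivl_Suc' upd mult_ac)
    also have "\<dots> =
        (\<Sum>k\<in>K. (c k * (\<Prod>a\<in>{1..n}. f k a (z a))) * ?I k (Suc n))"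
      by (subst contour_integral_sum[OF assms(1)])
        (auto intro!: contour_integrable_lmul[OF Suc.prems] sum.cong contour_integral_lmul[OF Suc.prems]
          simp del: times_divide_eq_right)
    finally show ?thesis by (simp add: mult_ac)
  qed
  hence "torus_contour_integral (Suc n) (\<lambda>z. \<Sum>k\<in>K. c k * (\<Prod>a\<in>{1..Suc n}. f k a (z a))) =
      torus_contour_integral n (\<lambda>z. \<Sum>k\<in>K. (c k * ?I k (Suc n)) * (\<Prod>a\<in>{1..n}. f k a (z a)))"
    by simp
  also have "\<dots> = (\<Sum>k\<in>K. (c k * ?I k (Suc n)) * (\<Prod>a\<in>{1..n}. ?I k a))"
    by (rule Suc.IH) (use Suc.prems in auto)
  finally show ?case by (simp add: prod.nat_ivl_Suc' mult_ac)
qed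

section \<open>Vandermonde determinants and sums over permutations\<close>

lemma det_vandermonde:
  fixes x :: "nat \<Rightarrow> 'a :: idom"
  shows "det (mat n n (\<lambda>(i, j). x i ^ j)) = (\<Prod>i<n. \<Prod>j\<in>{i<..<n}. x j - x i)"
proof (induction n)
  case 0
  show ?case by simp
next
  case (Suc n)
  define A where "A = mat (Suc n) (Suc n) (\<lambda>(i, j). x i ^ j)"
  \<comment> \<open>Right multiplication by C subtracts \<open>x n\<close> times the preceding
    column from each column. The last row of the product becomes (1, 0, ..., 0), and every other row
    i acquires the factor \<open>x i - x n\<close> outside column 0.\<close>
  define C where "C = mat (Suc n) (Suc n) (\<lambda>(i, j). (if i = j then 1 else 0) - (if Suc i = j then x n else 0))"
  define D where "D = mat n n (\<lambda>(i, j). if i = j then x i - x n else 0)"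
  define V where "V = mat n n (\<lambda>(i, j). x i ^ j)"
  have carr: "A \<in> carrier_mat (Suc n) (Suc n)" "C \<in> carrier_mat (Suc n) (Suc n)"
    "D \<in> carrier_mat n n" "V \<in> carrier_mat n n"
    by (auto simp: A_def C_def D_def V_def)
  have AC: "(A * C) $$ (i, j) = (case j of 0 \<Rightarrow> 1 | Suc k \<Rightarrow> (x i - x n) * x i ^ k)"
    if "i < Suc n" "j < Suc n" for i j
  proof -
    have "(A * C) $$ (i, j) = (\<Sum>k<Suc n. x i ^ k * C $$ (k, j))"
      using that carr by (auto simp: A_def C_def scalar_prod_def lessThan_atLeast0 intro!: sum.cong)
    also have "\<dots> = (\<Sum>k<Suc n. (if k = j then x i ^ k else 0) - (if Suc k = j then x i ^ k * x n else 0))"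
      using that by (intro sum.cong) (auto simp: C_def)
    also have "\<dots> = x i ^ j - (\<Sum>k<Suc n. if Suc k = j then x i ^ k * x n else 0)"
      using that by (simp add: sum_subtractf del: sum.lessThan_Suc)
    also have "(\<Sum>k<Suc n. if Suc k = j then x i ^ k * x n else 0) = (case j of 0 \<Rightarrow> 0 | Suc k \<Rightarrow> x i ^ k * x n)"
      using that by (cases j) (simp_all del: sum.lessThan_Suc)
    finally show ?thesis
      by (cases j) (simp_all add: algebra_simps del: index_mult_mat(1))
  qed
  have "det C = 1"
    using carr by (subst det_upper_triangular[of _ "Suc n"])
      (auto simp: C_def prod_list_diag_mat[of _ "Suc n"] intro!: prod.neutral)
  hence "det A = det (A * C)" using carr by (simp add: det_mult)
  also have "\<dots> = (\<Sum>j<Suc n. (A * C) $$ (n, j) * cofactor (A * C) n j)"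
    using carr by (intro laplace_expansion_row) auto
  also have "\<dots> = (\<Sum>j<Suc n. if j = 0 then cofactor (A * C) n 0 else 0)"
    by (intro sum.cong) (auto simp: AC split: nat.split)
  also have "\<dots> = cofactor (A * C) n 0" by (simp del: sum.lessThan_Suc)
  also have "\<dots> = (- 1) ^ n * det (mat_delete (A * C) n 0)"
    by (simp add: cofactor_def)
  also have "mat_delete (A * C) n 0 = D * V"
  proof (rule eq_matI)
    fix i j assume "i < dim_row (D * V)" "j < dim_col (D * V)"
    hence ij: "i < n" "j < n" using carr by auto
    have "(D * V) $$ (i, j) = (\<Sum>k<n. D $$ (i, k) * V $$ (k, j))"
      using ij carr by (auto simp: scalar_prod_def lessThan_atLeast0)
    also have "\<dots> = (\<Sum>k<n. if k = i then (x i - x n) * x i ^ j else 0)"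
      using ij by (intro sum.cong) (auto simp: D_def V_def)
    also have "\<dots> = (x i - x n) * x i ^ j" using ij by simp
    also have "\<dots> = mat_delete (A * C) n 0 $$ (i, j)"
      using ij carr AC[of i "Suc j"] by (simp add: mat_delete_def del: index_mult_mat(1))
    finally show "mat_delete (A * C) n 0 $$ (i, j) = (D * V) $$ (i, j)" ..
  qed (use carr in auto)
  also have "det (D * V) = (\<Prod>i<n. x i - x n) * det V"
  proof -
    have "det D = (\<Prod>i<n. x i - x n)"
      by (subst det_upper_triangular[of _ n]) (auto simp: D_def prod_list_diag_mat[of _ n])
    thus ?thesis using carr by (simp add: det_mult[of _ n])
  qed
  finally have "det A = (- 1) ^ n * (\<Prod>i<n. x i - x n) * det V"
    by (simp add: mult.assoc)
  \<comment> \<open>The cofactor sign flips each of the n differences into the required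
    orientation.\<close>
  also have "(- 1) ^ n * (\<Prod>i<n. x i - x n) = (\<Prod>i<n. (- 1) * (x i - x n))"
    by (simp only: prod.distrib prod_constant card_lessThan)
  also have "\<dots> = (\<Prod>i<n. x n - x i)" by simp
  finally have "det A = (\<Prod>i<n. x n - x i) * det V" .
  moreover have "(\<Prod>i<n. \<Prod>j\<in>{i<..<Suc n}. x j - x i) = (\<Prod>i<n. (x n - x i) * (\<Prod>j\<in>{i<..<n}. x j - x i))"
  proof (rule prod.cong[OF refl])
    fix i assume "i \<in> {..<n}"
    hence "{i<..<Suc n} = insert n {i<..<n}" by auto
    thus "(\<Prod>j\<in>{i<..<Suc n}. x j - x i) = (x n - x i) * (\<Prod>j\<in>{i<..<n}. x j - x i)" by simp
  qed
  moreover have "{n<..<Suc n} = {}" by auto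
  ultimately show ?case
    by (simp add: A_def V_def Suc prod.distrib)
qed

lemma permutes_less:
  "p permutes {0..<n :: nat} \<Longrightarrow> i < n \<Longrightarrow> p i < n"
  using permutes_in_image[of p "{0..<n}" i] by auto

text \<open>For fixed \<tau> the sum over \<sigma> is the determinant of A with its rows permuted by
  \<tau>. The resulting sign cancels against the sign of \<tau>, so each of the n! choices of \<tau>
  contributes the same value.\<close>

lemma sum_permutations_pair_eq_det:
  fixes A :: "'a :: comm_ring_1 mat"
  assumes A: "A \<in> carrier_mat n n"
  shows "(\<Sum>(\<sigma>, \<tau>)\<in>{p. p permutes {0..<n}} \<times> {p. p permutes {0..<n}}.
            signof \<sigma> * signof \<tau> * (\<Prod>i<n. A $$ (\<tau> i, \<sigma> i))) = of_nat (fact n) * det A"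
proof -
  let ?P = "{p. p permutes {0..<n}}"
  have "(\<Sum>\<sigma>\<in>?P. signof \<sigma> * signof \<tau> * (\<Prod>i<n. A $$ (\<tau> i, \<sigma> i))) = det A"
    if \<tau>: "\<tau> \<in> ?P" for \<tau>
  proof -
    have "det (mat n n (\<lambda>(i, j). A $$ (\<tau> i, j))) =
        (\<Sum>\<sigma>\<in>?P. signof \<sigma> * (\<Prod>i<n. A $$ (\<tau> i, \<sigma> i)))"
      by (subst det_def'[of _ n]) (auto simp: atLeast0LessThan permutes_less intro!: sum.cong prod.cong)
    hence "(\<Sum>\<sigma>\<in>?P. signof \<sigma> * (\<Prod>i<n. A $$ (\<tau> i, \<sigma> i))) = signof \<tau> * det A"
      using det_permute_rows[OF A, of \<tau>] \<tau> by simp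
    hence "signof \<tau> * (\<Sum>\<sigma>\<in>?P. signof \<sigma> * (\<Prod>i<n. A $$ (\<tau> i, \<sigma> i))) = det A"
      by (simp flip: mult.assoc of_int_mult)
    thus ?thesis by (simp add: sum_distrib_left mult_ac)
  qed
  hence "(\<Sum>\<tau>\<in>?P. \<Sum>\<sigma>\<in>?P. signof \<sigma> * signof \<tau> * (\<Prod>i<n. A $$ (\<tau> i, \<sigma> i))) = of_nat (card ?P) * det A"
    by simp
  also have "card ?P = fact n" by (subst card_permutations[of _ n]) auto
  finally show ?thesis
    by (subst (asm) sum.swap) (simp add: sum.cartesian_product)
qed

text \<open>On the unit circle conjugation is inversion, so |z_a - z_b|^2 = (z_b - z_a) (1/z_b -
  1/z_a), and the product splits into a Vandermonde determinant in the variables and one in their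
  inverses.\<close>

lemma norm_vandermonde_eq_det:
  fixes z :: "nat \<Rightarrow> complex"
  assumes "\<And>a. a \<in> {1..n} \<Longrightarrow> norm (z a) = 1"
  shows "(\<Prod>a\<in>{1..n}. \<Prod>b\<in>{a<..n}. complex_of_real ((norm (z a - z b))\<^sup>2)) =
         det (mat n n (\<lambda>(i, j). z (Suc i) ^ j)) * det (mat n n (\<lambda>(i, j). inverse (z (Suc i)) ^ j))"
proof -
  have inv: "inverse (z (Suc i)) = cnj (z (Suc i))" if "i < n" for i
    using assms[of "Suc i"] that complex_norm_square[of "z (Suc i)"] by (intro inverse_unique) simp
  have "(\<Prod>a\<in>{1..n}. \<Prod>b\<in>{a<..n}. complex_of_real ((norm (z a - z b))\<^sup>2)) =
      (\<Prod>i<n. \<Prod>j\<in>{i<..<n}. complex_of_real ((norm (z (Suc i) - z (Suc j)))\<^sup>2))"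
    unfolding One_nat_def prod.atLeast1_atMost_eq
  proof (rule prod.cong[OF refl])
    fix i
    have "{Suc i<..n} = Suc ` {i<..<n}"
      unfolding set_eq_iff
    proof (rule allI)
      fix b show "b \<in> {Suc i<..n} \<longleftrightarrow> b \<in> Suc ` {i<..<n}" by (cases b) auto
    qed
    thus "(\<Prod>b\<in>{Suc i<..n}. complex_of_real ((norm (z (Suc i) - z b))\<^sup>2)) =
        (\<Prod>j\<in>{i<..<n}. complex_of_real ((norm (z (Suc i) - z (Suc j)))\<^sup>2))"
      by (simp add: prod.reindex)
  qed
  also have "\<dots> = (\<Prod>i<n. \<Prod>j\<in>{i<..<n}. (z (Suc j) - z (Suc i)) * (inverse (z (Suc j)) - inverse (z (Suc i))))"
  proof (intro prod.cong refl)
    fix i j assume "i \<in> {..<n}" "j \<in> {i<..<n}"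
    thus "complex_of_real ((norm (z (Suc i) - z (Suc j)))\<^sup>2) =
        (z (Suc j) - z (Suc i)) * (inverse (z (Suc j)) - inverse (z (Suc i)))"
      by (simp add: inv norm_minus_commute[of "z (Suc i)"] complex_norm_square del: of_real_power)
  qed
  also have "\<dots> = det (mat n n (\<lambda>(i, j). z (Suc i) ^ j)) * det (mat n n (\<lambda>(i, j). inverse (z (Suc i)) ^ j))"
    by (simp add: det_vandermonde[of n "\<lambda>i. z (Suc i)"] det_vandermonde[of n "\<lambda>i. inverse (z (Suc i))"]
        prod.distrib)
  finally show ?thesis .
qed

text \<open>Heine's formula: expanding both Vandermonde determinants over permutations leaves
  products of one-variable integrals. The double sum over permutations then collapses to n! times
  one determinant.\<close>

lemma torus_contour_integral_vandermonde:
  assumes int: "\<And>i j. i < n \<Longrightarrow> j < n \<Longrightarrow>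
      (\<lambda>w. w ^ j * inverse w ^ i * f w / w) contour_integrable_on circlepath 0 1"
  shows "torus_contour_integral n (\<lambda>z. (\<Prod>a\<in>{1..n}. \<Prod>b\<in>{a<..n}. complex_of_real ((norm (z a - z b))\<^sup>2)) *
             (\<Prod>a\<in>{1..n}. f (z a))) =
         fact n * det (mat n n (\<lambda>(i, j).
             contour_integral (circlepath 0 1) (\<lambda>w. w ^ j * inverse w ^ i * f w / w)))"
proof -
  let ?P = "{p. p permutes {0..<n}}"
  let ?I = "\<lambda>i j. contour_integral (circlepath 0 1) (\<lambda>w. w ^ j * inverse w ^ i * f w / w)"
  have fin: "finite (?P \<times> ?P)" by (simp add: finite_permutations)
  have less: "p i < n" if "p \<in> ?P" "i < n" for p i
    using that by (auto simp: permutes_less)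
  have "torus_contour_integral n (\<lambda>z. (\<Prod>a\<in>{1..n}. \<Prod>b\<in>{a<..n}. complex_of_real ((norm (z a - z b))\<^sup>2)) *
             (\<Prod>a\<in>{1..n}. f (z a))) =
     torus_contour_integral n (\<lambda>z. \<Sum>k\<in>?P \<times> ?P. (signof (fst k) * signof (snd k)) *
        (\<Prod>a\<in>{1..n}. z a ^ fst k (a - 1) * inverse (z a) ^ snd k (a - 1) * f (z a)))"
  proof (rule torus_contour_integral_cong)
    fix z :: "nat \<Rightarrow> complex" assume z: "\<And>a. a \<in> {1..n} \<Longrightarrow> norm (z a) = 1"
    have "(\<Prod>a\<in>{1..n}. \<Prod>b\<in>{a<..n}. complex_of_real ((norm (z a - z b))\<^sup>2)) =
        det (mat n n (\<lambda>(i, j). z (Suc i) ^ j)) * det (mat n n (\<lambda>(i, j). inverse (z (Suc i)) ^ j))"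
      using z by (rule norm_vandermonde_eq_det)
    also have "\<dots> =
        (\<Sum>\<sigma>\<in>?P. signof \<sigma> * (\<Prod>i<n. z (Suc i) ^ \<sigma> i)) *
        (\<Sum>\<tau>\<in>?P. signof \<tau> * (\<Prod>i<n. inverse (z (Suc i)) ^ \<tau> i))"
      by (simp add: det_def'[of _ n] atLeast0LessThan less del: inverse_eq_divide power_inverse)
    also have "\<dots> = (\<Sum>k\<in>?P \<times> ?P. (signof (fst k) * signof (snd k)) *
           (\<Prod>a\<in>{1..n}. z a ^ fst k (a - 1) * inverse (z a) ^ snd k (a - 1)))"
      by (simp add: sum_product sum.cartesian_product prod.atLeast1_atMost_eq prod.distrib
          case_prod_unfold mult_ac del: inverse_eq_divide power_inverse)
    finally show "(\<Prod>a\<in>{1..n}. \<Prod>b\<in>{a<..n}. complex_of_real ((norm (z a - z b))\<^sup>2)) * (\<Prod>a\<in>{1..n}. f (z a)) =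
        (\<Sum>k\<in>?P \<times> ?P. (signof (fst k) * signof (snd k)) *
           (\<Prod>a\<in>{1..n}. z a ^ fst k (a - 1) * inverse (z a) ^ snd k (a - 1) * f (z a)))"
      by (simp only: sum_distrib_right prod.distrib mult.assoc)
  qed
  also have "\<dots> = (\<Sum>k\<in>?P \<times> ?P. (signof (fst k) * signof (snd k)) *
        (\<Prod>a\<in>{1..n}. ?I (snd k (a - 1)) (fst k (a - 1))))"
  proof (rule torus_contour_integral_sum_prod[OF fin,
        where f = "\<lambda>k a w. w ^ fst k (a - 1) * inverse w ^ snd k (a - 1) * f w"])
    fix k a assume "k \<in> ?P \<times> ?P" "a \<in> {1..n}"
    thus "(\<lambda>w. w ^ fst k (a - 1) * inverse w ^ snd k (a - 1) * f w / w) contour_integrable_on circlepath 0 1"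
      using less[of "fst k" "a - 1"] less[of "snd k" "a - 1"] by (intro int) (auto simp: mem_Times_iff)
  qed
  also have "\<dots> = (\<Sum>(\<sigma>, \<tau>)\<in>?P \<times> ?P. signof \<sigma> * signof \<tau> *
        (\<Prod>i<n. mat n n (\<lambda>(i, j). ?I i j) $$ (\<tau> i, \<sigma> i)))"
  proof (rule sum.cong[OF refl])
    fix k assume k: "k \<in> ?P \<times> ?P"
    have "(\<Prod>a\<in>{1..n}. ?I (snd k (a - 1)) (fst k (a - 1))) = (\<Prod>i<n. ?I (snd k i) (fst k i))"
      by (simp add: prod.atLeast1_atMost_eq)
    also have "\<dots> = (\<Prod>i<n. mat n n (\<lambda>(i, j). ?I i j) $$ (snd k i, fst k i))"
      using k less[of "snd k"] less[of "fst k"] by (intro prod.cong) (simp_all add: mem_Times_iff)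
    finally show "signof (fst k) * signof (snd k) * (\<Prod>a\<in>{1..n}. ?I (snd k (a - 1)) (fst k (a - 1))) =
        (case k of (\<sigma>, \<tau>) \<Rightarrow> signof \<sigma> * signof \<tau> * (\<Prod>i<n. mat n n (\<lambda>(i, j). ?I i j) $$ (\<tau> i, \<sigma> i)))"
      by (simp only: case_prod_unfold)
  qed
  also have "\<dots> = fact n * det (mat n n (\<lambda>(i, j). ?I i j))"
    by (subst sum_permutations_pair_eq_det) simp_all
  finally show ?thesis .
qed

section \<open>The residue functional\<close>

text \<open>By Cauchy's formula for derivatives the integral extracts the coefficient of (u - t)^k
  in u^n, which is 1 for n = k and 0 for n < k.\<close>

lemma contour_integral_power_over_linear_power:
  fixes t :: complex
  assumes "norm t < 1" and "n \<le> k"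
  shows "contour_integral (circlepath 0 1) (\<lambda>u. u ^ n / (u - t) ^ Suc k) = (if n = k then 2 * pi * \<i> else 0)"
proof -
  have "((\<lambda>u. u ^ n / (u - t) ^ Suc k) has_contour_integral
      (2 * pi * \<i>) / fact k * (deriv ^^ k) (\<lambda>u. u ^ n) t) (circlepath 0 1)"
    using assms(1) by (intro Cauchy_has_contour_integral_higher_derivative_circlepath)
      (auto intro!: continuous_intros holomorphic_intros)
  moreover have "(deriv ^^ k) (\<lambda>u. u ^ n) t = (if n = k then fact k else 0)"
    using higher_deriv_power[of k 0 n t] assms(2)
    by (auto simp: pochhammer_fact pochhammer_0_left Suc_diff_le not_less_eq_eq)
  ultimately show ?thesis
    by (auto dest!: contour_integral_unique)
qed

text \<open>Cauchy's formula at the centre 0 is applied to u f(u), which vanishes there; dividing by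
  u gives back f on the circle. Only continuity is demanded on the boundary.\<close>

lemma contour_integral_holomorphic_0:
  assumes "continuous_on (cball 0 1) f" and "f holomorphic_on ball 0 1"
  shows "contour_integral (circlepath 0 1) f = 0"
proof -
  have "((\<lambda>u. u * f u / (u - 0) ^ Suc 0) has_contour_integral
      (2 * pi * \<i>) / fact 0 * (deriv ^^ 0) (\<lambda>u. u * f u) 0) (circlepath 0 1)"
    by (intro Cauchy_has_contour_integral_higher_derivative_circlepath)
      (auto intro!: continuous_intros holomorphic_intros assms)
  hence "((\<lambda>u. u * f u / (u - 0) ^ Suc 0) has_contour_integral 0) (circlepath 0 1)"
    by simp
  hence "(f has_contour_integral 0) (circlepath 0 1)"
    by (rule has_contour_integral_eq) auto
  thus ?thesis by (rule contour_integral_unique)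
qed

definition residue_functional :: "complex poly \<Rightarrow> complex poly \<Rightarrow> complex poly \<Rightarrow> complex" where
  "residue_functional P q g = contour_integral (circlepath 0 1) (\<lambda>z. poly g z / (poly P z * poly q z)) / (2 * pi * \<i>)"

context
  fixes t w :: complex and M :: nat
  assumes t: "norm t < 1" and w: "norm w < 1"
begin

lemma linear_nonzero:
  shows "norm z = 1 \<Longrightarrow> z - t \<noteq> 0" and "norm z \<le> 1 \<Longrightarrow> 1 - w * z \<noteq> 0"
proof -
  show "z - t \<noteq> 0" if "norm z = 1" using that t by auto
  show "1 - w * z \<noteq> 0" if "norm z \<le> 1"
  proof
    assume "1 - w * z = 0"
    hence "norm (w * z) = 1" by simp
    moreover have "norm (w * z) \<le> norm w * 1"
      unfolding norm_mult using that by (intro mult_left_mono) auto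
    ultimately show False using w by simp
  qed
qed

lemma residue_functional_integrable:
  "(\<lambda>z. poly g z / (poly ([:-t, 1:] ^ M) z * poly ([:1, -w:] ^ M) z)) contour_integrable_on circlepath 0 1"
  by (rule contour_integrable_continuous_circlepath)
    (use linear_nonzero in \<open>auto intro!: continuous_intros simp: mult.commute[of _ w]\<close>)

lemma residue_functional_add:
  "residue_functional ([:-t, 1:] ^ M) ([:1, -w:] ^ M) (f + g) =
   residue_functional ([:-t, 1:] ^ M) ([:1, -w:] ^ M) f + residue_functional ([:-t, 1:] ^ M) ([:1, -w:] ^ M) g"
  unfolding residue_functional_def poly_add add_divide_distrib
  by (subst contour_integral_add[OF residue_functional_integrable residue_functional_integrable])
    (simp add: add_divide_distrib)

lemma residue_functional_smult:
  "residue_functional ([:-t, 1:] ^ M) ([:1, -w:] ^ M) (smult c f) =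
   c * residue_functional ([:-t, 1:] ^ M) ([:1, -w:] ^ M) f"
  unfolding residue_functional_def poly_smult times_divide_eq_right[symmetric]
  by (subst contour_integral_lmul[OF residue_functional_integrable]) simp

text \<open>After P cancels, the integrand f / q has no pole in the closed disc, because 1 - w z
  does not vanish for |z| <= 1.\<close>

lemma residue_functional_mult_P:
  "residue_functional ([:-t, 1:] ^ M) ([:1, -w:] ^ M) ([:-t, 1:] ^ M * f) = 0"
proof -
  have "contour_integral (circlepath 0 1)
      (\<lambda>z. poly ([:-t, 1:] ^ M * f) z / (poly ([:-t, 1:] ^ M) z * poly ([:1, -w:] ^ M) z)) =
    contour_integral (circlepath 0 1) (\<lambda>z. poly f z / poly ([:1, -w:] ^ M) z)"
    by (rule contour_integral_eq) (use linear_nonzero(1) in auto)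
  also have "\<dots> = 0"
    by (rule contour_integral_holomorphic_0)
      (use linear_nonzero(2) in \<open>auto intro!: continuous_intros holomorphic_intros simp: mult.commute[of _ w]\<close>)
  finally show ?thesis by (simp add: residue_functional_def)
qed

text \<open>After q cancels, z^n / (z - t)^M remains. These values are what makes the product of Q
  with the Toeplitz matrix unitriangular.\<close>

lemma residue_functional_mult_q:
  assumes "Suc n \<le> M"
  shows "residue_functional ([:-t, 1:] ^ M) ([:1, -w:] ^ M) (monom 1 n * [:1, -w:] ^ M) = (if Suc n = M then 1 else 0)"
proof -
  obtain k where k: "M = Suc k" using assms by (cases M) auto
  have "contour_integral (circlepath 0 1)
      (\<lambda>z. poly (monom 1 n * [:1, -w:] ^ M) z / (poly ([:-t, 1:] ^ M) z * poly ([:1, -w:] ^ M) z)) =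
    contour_integral (circlepath 0 1) (\<lambda>z. z ^ n / (z - t) ^ Suc k)"
    by (rule contour_integral_eq)
      (use linear_nonzero(2) in \<open>auto simp: poly_monom k mult.commute[of _ w] simp del: power_Suc\<close>)
  thus ?thesis
    using assms contour_integral_power_over_linear_power[OF t, of n k]
    by (simp add: residue_functional_def k)
qed

lemma det_mulmat_times_det_toeplitz:
  assumes "M = N + K"
  shows "(1 - t * w) ^ (M\<^sup>2) * det (mat N N (\<lambda>(i, j).
           residue_functional ([:-t, 1:] ^ M) ([:1, -w:] ^ M) (monom 1 (M - Suc i + j)))) =
         det (mat K K (\<lambda>(i, j). mulmat ([:-t, 1:] ^ M) ([:1, -w:] ^ M) $$ (N + i, N + j)))"
\<comment> \<open>The determinant of multiplication by q was computed for P of positive degree; for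
  M = 0 all matrices are empty.\<close>
proof (cases "M = 0")
  case True
  thus ?thesis using assms by simp
next
  case False
  have deg: "degree ([:-t, 1:] ^ M) = M" by (simp add: degree_linear_power)
  have "lead_coeff ([:-t, 1:] ^ M) = 1" by (simp add: deg coeff_linear_power)
  hence "det (mulmat ([:-t, 1:] ^ M) ([:1, -w:] ^ M)) = poly (reflect_poly ([:-t, 1:] ^ M)) w ^ M"
    using False by (intro det_mulmat_linear_power) (simp_all add: deg)
  \<comment> \<open>Reversing (z - t)^M gives (1 - t z)^M. Its value at w is raised to the power M
    because q has M linear factors.\<close>
  also have "\<dots> = (1 - t * w) ^ (M\<^sup>2)"
    by (simp add: reflect_poly_power reflect_poly_def[of "[:-t, 1:]"] power_mult power2_eq_square mult.commute)
  finally have "det (mulmat ([:-t, 1:] ^ M) ([:1, -w:] ^ M)) = (1 - t * w) ^ (M\<^sup>2)" .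
  moreover have "det (mulmat ([:-t, 1:] ^ M) ([:1, -w:] ^ M)) *
      det (mat N N (\<lambda>(i, j). residue_functional ([:-t, 1:] ^ M) ([:1, -w:] ^ M) (monom 1 (N + K - Suc i + j)))) =
      det (mat K K (\<lambda>(i, j). mulmat ([:-t, 1:] ^ M) ([:1, -w:] ^ M) $$ (N + i, N + j)))"
    by (rule det_minor_linear_functional)
      (simp_all add: deg assms[symmetric] residue_functional_add residue_functional_smult
        residue_functional_mult_P residue_functional_mult_q)
  ultimately show ?thesis using assms by simp
qed

end

section \<open>The complementary minor\<close>

lemma det_mat_2:
  "det (mat 2 2 (\<lambda>(i, j). f i j)) = f 0 0 * f 1 1 - f 0 1 * f 1 0"
  by (subst laplace_expansion_row[of _ 2 0])
    (simp_all add: cofactor_def det_single mat_delete_def numeral_2_eq_2)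

lemma det_mat_3:
  "det (mat 3 3 (\<lambda>(i, j). f i j)) =
     f 0 0 * (f 1 1 * f 2 2 - f 1 2 * f 2 1)
   - f 0 1 * (f 1 0 * f 2 2 - f 1 2 * f 2 0)
   + f 0 2 * (f 1 0 * f 2 1 - f 1 1 * f 2 0)"
proof -
  have del: "mat_delete (mat 3 3 (\<lambda>(i, j). f i j)) 0 k =
      mat 2 2 (\<lambda>(i, j). f (Suc i) (if j < k then j else Suc j))" if "k < 3" for k
    using that by (intro eq_matI) (auto simp: mat_delete_def)
  have minor: "det (mat_delete (mat 3 3 (\<lambda>(i, j). f i j)) 0 k) =
      f 1 (if 0 < k then 0 else 1) * f 2 (if 1 < k then 1 else 2) -
      f 1 (if 1 < k then 1 else 2) * f 2 (if 0 < k then 0 else 1)" if "k < 3" for k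
    unfolding del[OF that] det_mat_2 by (simp add: numeral_2_eq_2)
  have "{..<3} = {0, 1, 2 :: nat}" by auto
  hence "det (mat 3 3 (\<lambda>(i, j). f i j)) = (\<Sum>k\<in>{0, 1, 2}. f 0 k * ((- 1) ^ k *
      (f 1 (if 0 < k then 0 else 1) * f 2 (if 1 < k then 1 else 2) -
       f 1 (if 1 < k then 1 else 2) * f 2 (if 0 < k then 0 else 1))))"
    by (subst laplace_expansion_row[of _ 3 0]) (auto simp: cofactor_def minor simp del: One_nat_def)
  thus ?thesis by (simp add: algebra_simps)
qed

text \<open>The rows (a0, a1, a2), (b0, b1, b2), (c0, c1, c2) are, up to powers of t and w, the three lowest
  coefficients of the remainders of q, z q and z^2 q, where q = (1 - w z)^M is divided by (z - t)^M,
  s = t w, y = s^(M-2), m = M and B = (M choose 2). Likewise p and r are, up to sign and monomials,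
  the top coefficients of the first two remainders.\<close>

lemma corner_identity:
  fixes s y m B :: "'a :: comm_ring_1"
  defines "p \<equiv> m * (1 - s)"
  defines "r \<equiv> (1 - s) * (B * (1 + s) - m^2 * s)"
  defines "a0 \<equiv> 1 - s^2 * y" and "a1 \<equiv> - (m * (1 - s * y))" and "a2 \<equiv> B * (1 - y)"
  defines "b0 \<equiv> s * y * p" and "b1 \<equiv> a0 - m * s * y * p" and "b2 \<equiv> a1 + B * y * p"
  defines "c0 \<equiv> - (y * r)" and "c1 \<equiv> b0 + m * y * r" and "c2 \<equiv> b1 - B * y * r"
  shows "c2 * (b1 * a0 - s * b0 * a1) - s * c1 * (b2 * a0 - s * b0 * a2) + s^2 * c0 * (b2 * a1 - b1 * a2) =
    1 - y * (r^2 + s * (2 * p^2 + 3 * s)) + y^2 * s^2 * (r * (r - 2 * p^2) + p^4 + 2 * p^2 * s + 3 * s^2)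
      - y^3 * s^6"
  unfolding a0_def a1_def a2_def b0_def b1_def b2_def c0_def c1_def c2_def p_def r_def
  by (simp add: algebra_simps power2_eq_square power3_eq_cube power4_eq_xxxx eval_nat_numeral)

lemma det_mulmat_corner:
  fixes t w :: "'a :: field" and N :: nat
  defines "m \<equiv> of_nat (N + 3)" and "B \<equiv> of_nat ((N + 3) choose 2)" and "s \<equiv> t * w"
  defines "p \<equiv> m * (1 - s)" and "r \<equiv> (1 - s) * (B * (1 + s) - m^2 * s)" and "y \<equiv> s ^ (N + 1)"
  shows "det (mat 3 3 (\<lambda>(i, j). mulmat ([:-t, 1:] ^ (N + 3)) ([:1, -w:] ^ (N + 3)) $$ (N + i, N + j))) =
    1 - y * (r^2 + s * (2 * p^2 + 3 * s)) + y^2 * s^2 * (r * (r - 2 * p^2) + p^4 + 2 * p^2 * s + 3 * s^2)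
      - y^3 * s^6"
proof -
  define P where "P = [:-t, 1:] ^ (N + 3)"
  define q where "q = [:1, -w:] ^ (N + 3)"
  \<comment> \<open>Splitting off the sign e and the powers u and v leaves coefficients with only
    small explicit exponents. The signs cancel in pairs through e e = 1, and u v = y.\<close>
  define e :: 'a where "e = (- 1) ^ (N + 1)"
  define u where "u = t ^ (N + 1)"
  define v where "v = w ^ (N + 1)"
  have e: "e * e = 1" unfolding e_def by (simp flip: power_mult_distrib)
  have y: "y = u * v" by (simp add: y_def u_def v_def s_def power_mult_distrib)
  have Suc_N: "N + 2 = Suc (N + 1)" "N + 3 = Suc (Suc (N + 1))" by simp_all
  have minus_power: "(- x) ^ (N + 1) = e * x ^ (N + 1)" "(- x) ^ (N + 2) = - (e * x * x ^ (N + 1))"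
    "(- x) ^ (N + 3) = e * x\<^sup>2 * x ^ (N + 1)" for x :: 'a
    unfolding Suc_N power_Suc power2_eq_square power_minus[of x "N + 1"] e_def by (simp_all add: mult_ac)
  have deg: "degree P = N + 3" by (simp add: P_def degree_linear_power)
  have monic: "lead_coeff P = 1" by (simp add: deg) (simp add: P_def coeff_linear_power)
  have degq: "degree q \<le> N + 3"
    using degree_power_le[of "[:1, -w:]" "N + 3"] by (simp add: q_def split: if_splits)
  have P_coeff: "coeff P k = of_nat ((N + 3) choose k) * (-t) ^ (N + 3 - k)"
    and q_coeff: "coeff q k = of_nat ((N + 3) choose k) * (-w) ^ k"
    if "k \<le> N + 3" for k
    unfolding P_def q_def coeff_linear_poly_power[OF that] by simp_all
  have choose: "(N + 3) choose (N + 1) = (N + 3) choose 2" "(N + 3) choose (N + 2) = N + 3"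
    using binomial_symmetric[of 2 "N + 3"] binomial_symmetric[of 1 "N + 3"] by simp_all
  have sub: "N + 3 - 0 = N + 3" "N + 3 - 1 = N + 2" "N + 3 - 2 = N + 1"
    "N + 3 - (N + 2) = 1" "N + 3 - (N + 1) = 2" by simp_all
  note coeff_simps = choose sub minus_power choose_one binomial_n_0 binomial_n_n power_0 power_one_right
    of_nat_1 mult_1_left mult_1_right power2_minus mult_minus_left mult_minus_right minus_minus
    m_def[symmetric] B_def[symmetric]
  have P_coeffs: "coeff P 0 = e * t\<^sup>2 * u" "coeff P 1 = - (e * m * t * u)" "coeff P 2 = e * B * u"
    "coeff P (N + 1) = B * t\<^sup>2" "coeff P (N + 2) = - (m * t)"
    using P_coeff[of 0] P_coeff[of 1] P_coeff[of 2] P_coeff[of "N + 1"] P_coeff[of "N + 2"]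
    unfolding coeff_simps u_def by (simp_all add: mult_ac)
  have q_coeffs: "coeff q 0 = 1" "coeff q 1 = - (m * w)" "coeff q 2 = B * w\<^sup>2"
    "coeff q (N + 1) = e * B * v" "coeff q (N + 2) = - (e * m * w * v)" "coeff q (N + 3) = e * w\<^sup>2 * v"
    using q_coeff[of 0] q_coeff[of 1] q_coeff[of 2] q_coeff[of "N + 1"] q_coeff[of "N + 2"] q_coeff[of "N + 3"]
    unfolding coeff_simps v_def by (simp_all add: mult_ac)
  define R where "R = (\<lambda>l. (monom 1 l * q) mod P)"
  have R0: "coeff (R 0) k = coeff q k - coeff q (N + 3) * coeff P k" for k
    using mod_monic_eq[of P q] monic deg degq by (simp add: R_def flip: one_pCons)
  have R_Suc: "R (Suc l) = pCons 0 (R l) - smult (coeff (R l) (N + 2)) P" for l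
    using mod_shift_eq[OF monic, of l q] deg by (simp add: R_def)
  define a0 a1 a2 where "a0 = 1 - s^2 * y" and "a1 = - (m * (1 - s * y))" and "a2 = B * (1 - y)"
  define b0 b1 b2 where "b0 = s * y * p" and "b1 = a0 - m * s * y * p" and "b2 = a1 + B * y * p"
  define c0 c1 c2 where "c0 = - (y * r)" and "c1 = b0 + m * y * r" and "c2 = b1 - B * y * r"
  note defs = a0_def a1_def a2_def b0_def b1_def b2_def c0_def c1_def c2_def
  have ee: "e * (e * x) = x" for x using e by (simp flip: mult.assoc)
  \<comment> \<open>Besides the three lowest coefficients, the two top ones are recorded:
    \<open>N + 2\<close> gives the multiple of P subtracted at the next shift, and
    \<open>N + 1\<close> moves up into the top position of the following remainder.\<close>
  have R0': "coeff (R 0) 0 = a0" "coeff (R 0) 1 = w * a1" "coeff (R 0) 2 = w^2 * a2"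
    "coeff (R 0) (N + 1) = e * v * (B * (1 - s^2))" "coeff (R 0) (N + 2) = - (e * v * w * p)"
    unfolding R0 P_coeffs q_coeffs
    by (simp_all add: defs y p_def s_def algebra_simps power2_eq_square ee)
  have R_Suc_coeff: "coeff (R (Suc l)) 0 = - (coeff (R l) (N + 2) * coeff P 0)"
    "coeff (R (Suc l)) 1 = coeff (R l) 0 - coeff (R l) (N + 2) * coeff P 1"
    "coeff (R (Suc l)) 2 = coeff (R l) 1 - coeff (R l) (N + 2) * coeff P 2"
    "coeff (R (Suc l)) (N + 2) = coeff (R l) (N + 1) - coeff (R l) (N + 2) * coeff P (N + 2)" for l
    unfolding R_Suc by (simp_all add: numeral_2_eq_2)
  have R1: "coeff (R 1) 0 = t * b0" "coeff (R 1) 1 = b1" "coeff (R 1) 2 = w * b2"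
    "coeff (R 1) (N + 2) = e * v * r"
    using R_Suc_coeff[of 0] unfolding R0' P_coeffs One_nat_def[symmetric]
    by (simp_all add: y b0_def b1_def b2_def p_def r_def s_def algebra_simps power2_eq_square ee)
  have R2: "coeff (R 2) 0 = t\<^sup>2 * c0" "coeff (R 2) 1 = t * c1" "coeff (R 2) 2 = c2"
    using R_Suc_coeff[of 1] unfolding R1 P_coeffs Suc_1
    by (simp_all add: y c0_def c1_def c2_def algebra_simps power2_eq_square ee)
  \<comment> \<open>In the descending order the last three rows belong to z^2 q, z q, q and the last
    three columns to the coefficients of z^2, z, 1.\<close>
  have entry: "mulmat P q $$ (N + i, N + j) = coeff (R (2 - i)) (2 - j)" if "i < 3" "j < 3" for i j
    using that by (simp add: mulmat_def deg R_def numeral_3_eq_3)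
  have "mat 3 3 (\<lambda>(i, j). mulmat P q $$ (N + i, N + j)) = mat 3 3 (\<lambda>(i, j). coeff (R (2 - i)) (2 - j))"
    by (rule eq_matI) (auto simp: entry)
  also have "det \<dots> = c2 * (b1 * a0 - (t * b0) * (w * a1)) - (t * c1) * ((w * b2) * a0 - (t * b0) * (w^2 * a2))
      + (t^2 * c0) * ((w * b2) * (w * a1) - b1 * (w^2 * a2))"
    unfolding det_mat_3 using R0' R1 R2 by simp
  \<comment> \<open>In every term the displayed powers of t and w match, so only s = t w
    survives.\<close>
  also have "\<dots> = c2 * (b1 * a0 - s * b0 * a1) - s * c1 * (b2 * a0 - s * b0 * a2) + s^2 * c0 * (b2 * a1 - b1 * a2)"
    by (simp add: s_def algebra_simps power2_eq_square)
  also have "\<dots> = 1 - y * (r^2 + s * (2 * p^2 + 3 * s)) + y^2 * s^2 * (r * (r - 2 * p^2) + p^4 + 2 * p^2 * s + 3 * s^2)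
      - y^3 * s^6"
    unfolding defs p_def r_def by (rule corner_identity)
  finally show ?thesis by (simp add: P_def q_def)
qed

section \<open>The Hilbert series\<close>

text \<open>Writing 1 - t/u = (u - t)/u moves u^M into the numerator. Together with the 1/u of the
  measure this turns u^(j-i) into u^(M-1-i+j), a genuine monomial because i < M.\<close>

lemma contour_integral_sqcd_mode:
  fixes t w :: complex and i j M :: nat
  assumes t: "norm t < 1" and w: "norm w < 1" and i: "i < M"
  defines "f \<equiv> \<lambda>u. u ^ j * inverse u ^ i * (1 / ((1 - t / u) ^ M * (1 - w * u) ^ M)) / u"
  shows "f contour_integrable_on circlepath 0 1"
    and "contour_integral (circlepath 0 1) f =
      2 * pi * \<i> * residue_functional ([:-t, 1:] ^ M) ([:1, -w:] ^ M) (monom 1 (M - Suc i + j))"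
proof -
  define g where "g = (\<lambda>z. poly (monom 1 (M - Suc i + j)) z / (poly ([:-t, 1:] ^ M) z * poly ([:1, -w:] ^ M) z))"
  have eq: "g u = f u" if u: "u \<in> path_image (circlepath 0 1)" for u
  proof -
    have u0: "u \<noteq> 0" using u by auto
    have M: "M = (M - Suc i) + i + 1" using i by simp
    have "1 - t / u = (u - t) / u" using u0 by (simp add: field_simps)
    hence "f u = u ^ j * inverse u ^ i * (u ^ M / ((u - t) ^ M * (1 - w * u) ^ M)) / u"
      by (simp add: f_def power_divide)
    also have "u ^ M = u ^ (M - Suc i) * u ^ i * u"
      by (subst M) (simp add: power_add)
    also have "u ^ j * inverse u ^ i * (u ^ (M - Suc i) * u ^ i * u / ((u - t) ^ M * (1 - w * u) ^ M)) / u =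
        u ^ (M - Suc i + j) / ((u - t) ^ M * (1 - w * u) ^ M)"
      using u0 by (simp add: power_add power_inverse)
    finally show ?thesis
      by (simp add: g_def poly_monom mult.commute[of u])
  qed
  have g: "g contour_integrable_on circlepath 0 1"
    unfolding g_def by (rule residue_functional_integrable[OF t w])
  thus "f contour_integrable_on circlepath 0 1"
    by (rule contour_integrable_eq) (rule eq)
  have "contour_integral (circlepath 0 1) f = contour_integral (circlepath 0 1) g"
    by (rule contour_integral_eq) (rule eq[symmetric])
  thus "contour_integral (circlepath 0 1) f =
      2 * pi * \<i> * residue_functional ([:-t, 1:] ^ M) ([:1, -w:] ^ M) (monom 1 (M - Suc i + j))"
    by (simp add: residue_functional_def g_def)
qed

lemma sqcd_hilbert_series_eq_det:
  assumes "0 \<le> t" "t < 1" "0 \<le> tt" "tt < 1" "Nc \<le> M"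
  shows "sqcd_hilbert_series M Nc t tt = det (mat Nc Nc (\<lambda>(i, j).
    residue_functional ([:- complex_of_real t, 1:] ^ M) ([:1, - complex_of_real tt:] ^ M) (monom 1 (M - Suc i + j))))"
proof -
  let ?f = "\<lambda>u. 1 / ((1 - complex_of_real t / u) ^ M * (1 - complex_of_real tt * u) ^ M)"
  let ?L = "\<lambda>i j. residue_functional ([:- complex_of_real t, 1:] ^ M) ([:1, - complex_of_real tt:] ^ M) (monom 1 (M - Suc i + j))"
  let ?c = "2 * complex_of_real pi * \<i>"
  have norms: "norm (complex_of_real t) < 1" "norm (complex_of_real tt) < 1"
    using assms by simp_all
  note mode = contour_integral_sqcd_mode[OF norms]
  have "torus_contour_integral Nc (sqcd_integrand M Nc t tt) =
      fact Nc * det (mat Nc Nc (\<lambda>(i, j). contour_integral (circlepath 0 1) (\<lambda>u. u ^ j * inverse u ^ i * ?f u / u)))"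
    unfolding sqcd_integrand_def
    by (rule torus_contour_integral_vandermonde, rule mode(1)) (use assms(5) in simp)
  \<comment> \<open>Each of the Nc rows carries a factor 2 pi i; their product and the Nc! of
    Heine's formula cancel the prefactor of the series.\<close>
  also have "mat Nc Nc (\<lambda>(i, j). contour_integral (circlepath 0 1) (\<lambda>u. u ^ j * inverse u ^ i * ?f u / u)) =
      ?c \<cdot>\<^sub>m mat Nc Nc (\<lambda>(i, j). ?L i j)"
    by (rule eq_matI) (use assms mode(2) in auto)
  finally show ?thesis
    by (simp add: sqcd_hilbert_series_def)
qed

theorem mainTheorem6:
  fixes Nc Nf :: nat and t tt s D :: real
  assumes "Nc \<ge> 1" and "Nf = Nc + 3"
    and "0 \<le> t" and "t < 1" and "0 \<le> tt" and "tt < 1"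
    and "s = t * tt"
    and "D = 1
      - s ^ (Nf - 2) *
          ((1 - s)\<^sup>2 * (real (Nf choose 2) - real ((Nf + 1) choose 2) * s)\<^sup>2
           + s * (2 * real Nf ^ 2 * (1 - s)\<^sup>2 + 3 * s))
      + s ^ (2 * Nf - 2) *
          ((1 - s)\<^sup>2 * (real (Nf choose 2) - s * real ((Nf + 1) choose 2))
             * (real (Nf choose 2) - s * real ((Nf + 1) choose 2) - 2 * (1 - s) * real Nf ^ 2)
           + real Nf ^ 4 * (1 - s) ^ 4 + 2 * real Nf ^ 2 * (1 - s)\<^sup>2 * s + 3 * s\<^sup>2)
      - s ^ (3 * Nf)"
  shows "sqcd_hilbert_series Nf Nc t tt = complex_of_real (D / (1 - s) ^ (Nf\<^sup>2))"
proof -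
  define m where "m = real Nf"
  define B where "B = real (Nf choose 2)"
  define p where "p = m * (1 - s)"
  define r where "r = (1 - s) * (B * (1 + s) - m\<^sup>2 * s)"
  define y where "y = s ^ (Nc + 1)"
  \<comment> \<open>The relation m^2 = 2 B + m rewrites r through B and B + m, the two binomials
    occurring in D.\<close>
  have "real (Nf choose 2) = (m\<^sup>2 - m) / 2"
    using assms(2) by (simp add: m_def choose_two real_of_nat_div power2_eq_square algebra_simps)
  moreover have choose: "real ((Nf + 1) choose 2) = B + m"
    by (simp add: B_def m_def numeral_2_eq_2)
  ultimately have m2: "m\<^sup>2 = 2 * B + m"
    by (simp add: B_def)
  have r: "r = (1 - s) * (B - s * (B + m))"
    unfolding r_def m2 by (simp add: algebra_simps)
  \<comment> \<open>With y = s^(Nc+1) the three powers of s in D are y, y^2 s^2 and y^3 s^6, as in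
    the corner determinant.\<close>
  have exps: "Nf - 2 = Nc + 1" "2 * Nf - 2 = (Nc + 1) * 2 + 2" "3 * Nf = (Nc + 1) * 3 + 6"
    using assms(2) by simp_all
  have D: "D = 1 - y * (r\<^sup>2 + s * (2 * p\<^sup>2 + 3 * s))
      + y\<^sup>2 * s\<^sup>2 * (r * (r - 2 * p\<^sup>2) + p ^ 4 + 2 * p\<^sup>2 * s + 3 * s\<^sup>2) - y ^ 3 * s ^ 6"
    unfolding assms(8) choose exps power_add[of s "_ * _"] power_mult y_def[symmetric] B_def[symmetric] m_def[symmetric] r p_def
    by (simp add: algebra_simps power2_eq_square power4_eq_xxxx)
  have norms: "norm (complex_of_real t) < 1" "norm (complex_of_real tt) < 1"
    using assms by simp_all
  \<comment> \<open>This makes the factor (1 - s)^(Nf^2) nonzero, so that it can be divided out at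
    the end.\<close>
  have "s < 1"
    using mult_strict_mono'[of t 1 tt 1] assms by simp
  have "(1 - complex_of_real t * complex_of_real tt) ^ (Nf\<^sup>2) * sqcd_hilbert_series Nf Nc t tt =
      det (mat 3 3 (\<lambda>(i, j). mulmat ([:- complex_of_real t, 1:] ^ (Nc + 3)) ([:1, - complex_of_real tt:] ^ (Nc + 3)) $$ (Nc + i, Nc + j)))"
    using det_mulmat_times_det_toeplitz[OF norms assms(2)] sqcd_hilbert_series_eq_det[of t tt Nc Nf] assms(2-6)
    by simp
  also have "\<dots> = complex_of_real D"
    unfolding det_mulmat_corner D y_def r_def p_def m_def B_def assms(2,7) by simp
  finally have "complex_of_real ((1 - s) ^ (Nf\<^sup>2)) * sqcd_hilbert_series Nf Nc t tt = complex_of_real D"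
    by (simp add: assms(7))
  thus ?thesis
    using \<open>s < 1\<close> by (simp add: field_simps)
qed

end
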